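(* Let $C$ be a $d$-variate Archimedean copula with generator $\phi$ and let $(U_1,\ldots,U_d)$ have distribution function $C$. Let $\varnothing\neq I\subset\{1,\ldots,d\}$. If $\phi^{\leftarrow}$ is $|I|$ times continuously differentiable and if $(-D)^{|I|}\phi^{\leftarrow}(0)<\infty$, then $\phi'(1)<0$ and $$\lim_{s\downarrow 0}s^{-|I|}\Pr[\forall i\in I: U_i\geq 1-s x_i;\ \forall i\in I^c: U_i\leq y_i]=|\phi'(1)|^{|I|}\prod_{i\in I}x_i\cdot(-D)^{|I|}\phi^{\leftarrow}\Bigl(\sum_{i\in I^c}\phi(y_i)\Bigr)$$ whenever $0<x_i<\infty$ for $i\in I$ and $0<y_i\leq 1$ for $i\in I^c$.
   Context: Fix an integer $d\geq 2$. An Archimedean generator is a convex, decreasing function $\phi:[0,1]\to[0,\infty]$ with $\phi(1)=0$; its generalized inverse is $\phi^{\leftarrow}(y)=\inf\{t\in[0,1]:\phi(t)\leq y\}$ for $y\in[0,\infty]$. The Archimedean copula with generator $\phi$ is $C(u_1,\ldots,u_d)=\phi^{\leftarrow}(\phi(u_1)+\cdots+\phi(u_d))$ on $[0,1]^d$; it is assumed throughout that $C$ is indeed a copula, i.e. (the restriction to $[0,1]^d$ of) a distribution function with uniform$(0,1)$ margins (equivalently, $\phi^{\leftarrow}$ is $d$-monotone on $(0,\infty)$). $D$ is the derivative operator. Continuous differentiability of $\phi^{\leftarrow}$ is understood on $[0,\infty)$, derivatives at $0$ being limits from the right, which a priori may be infinite; so the hypothesis says that $(-D)^{|I|}\phi^{\leftarrow}$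 is continuous on $(0,\infty)$ and has a finite limit $(-D)^{|I|}\phi^{\leftarrow}(0)$ at $0$. $\phi'(1)=-\lim_{s\downarrow 0}\phi(1-s)/s$ is the left derivative at $1$, which exists by convexity. $I^c=\{1,\ldots,d\}\setminus I$, and an empty sum is $0$. *)

theory Defs
  imports "HOL-Probability.Probability"
begin

definition archimedean_generator :: "(real \<Rightarrow> ennreal) \<Rightarrow> bool" where
  "archimedean_generator \<phi> \<longleftrightarrow>
     (\<forall>s\<in>{0..1}. \<forall>t\<in>{0..1}. \<forall>a\<in>{0..1}.
        \<phi> ((1 - a) * s + a * t) \<le> ennreal (1 - a) * \<phi> s + ennreal a * \<phi> t) \<and>
     antimono_on {0..1} \<phi> \<and> \<phi> 1 = 0"

definition gen_inverse :: "(real \<Rightarrow> ennreal) \<Rightarrow> ennreal \<Rightarrow> real" where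
  "gen_inverse \<phi> y = Inf {t \<in> {0..1}. \<phi> t \<le> y}"

definition archimedean_copula :: "(real \<Rightarrow> ennreal) \<Rightarrow> real ^ 'd \<Rightarrow> real" where
  "archimedean_copula \<phi> u = gen_inverse \<phi> (\<Sum>i\<in>UNIV. \<phi> (u $ i))"

text \<open>The order on \<^typ>\<open>real ^ 'd\<close> is componentwise, so \<open>{0..1}\<close> below is the unit cube and
  \<open>{..u}\<close> the orthant below \<open>u\<close>. A copula is only considered on the unit cube, where it determines
  the distribution function.\<close>

definition has_df_on_cube :: "(real ^ 'd) measure \<Rightarrow> (real ^ 'd \<Rightarrow> real) \<Rightarrow> bool" where
  "has_df_on_cube N C \<longleftrightarrow> (\<forall>u\<in>{0..1}. measure N {..u} = C u)"

definition is_copula :: "(real ^ 'd \<Rightarrow> real) \<Rightarrow> bool" where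
  "is_copula C \<longleftrightarrow>
     (\<exists>N. prob_space N \<and> sets N = sets borel \<and> has_df_on_cube N C \<and>
          (\<forall>i. distr N borel (\<lambda>x. x $ i) = uniform_measure lborel {0<..<1}))"

text \<open>The value at \<open>1\<close> of the left derivative of \<open>\<phi>\<close>. If \<open>\<phi>\<close> generates a copula, it is finite on
  \<open>(0,1]\<close>, so \<^const>\<open>enn2real\<close> loses nothing, and the limit exists by convexity.\<close>

definition generator_deriv_1 :: "(real \<Rightarrow> ennreal) \<Rightarrow> real" where
  "generator_deriv_1 \<phi> = - Lim (at_right 0) (\<lambda>s. enn2real (\<phi> (1 - s)) / s)"

definition minus_D :: "(real \<Rightarrow> real) \<Rightarrow> real \<Rightarrow> real" where
  "minus_D f = (\<lambda>t. - deriv f t)"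

definition cont_diff_on_pos :: "nat \<Rightarrow> (real \<Rightarrow> real) \<Rightarrow> bool" where
  "cont_diff_on_pos k f \<longleftrightarrow>
     (\<forall>j<k. \<forall>t>0. (minus_D ^^ j) f differentiable (at t)) \<and>
     continuous_on {0<..} ((minus_D ^^ k) f)"

text \<open>\<open>(-D)\<^sup>k f\<close> on \<open>[0,\<infinity>)\<close>, its value at \<open>0\<close> being the limit from the right.\<close>

definition minus_D_pow :: "nat \<Rightarrow> (real \<Rightarrow> real) \<Rightarrow> real \<Rightarrow> real" where
  "minus_D_pow k f t =
     (if t = 0 then Lim (at_right 0) ((minus_D ^^ k) f) else (minus_D ^^ k) f t)"

text \<open>The restriction of the generalized inverse to finite arguments; only its values on
  \<open>[0,\<infinity>)\<close> are meaningful.\<close>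

definition gen_inverse_real :: "(real \<Rightarrow> ennreal) \<Rightarrow> real \<Rightarrow> real" where
  "gen_inverse_real \<phi> t = gen_inverse \<phi> (ennreal t)"

end

theory Submission
  imports Defs
begin

text \<open>Write \<open>\<psi>\<close> for the inverse generator and \<open>h\<^sub>i = \<phi> (1 - s x\<^sub>i)\<close>. By inclusion-exclusion the probability
  of the box is the alternating difference of \<open>\<psi>\<close> at \<open>T = (\<Sum>i\<in>-I. \<phi> (y\<^sub>i))\<close> with increments
  \<open>h\<^sub>i\<close>, \<open>i \<in> I\<close>, so by an iterated mean value theorem it equals
  \<open>(\<Prod>i\<in>I. h\<^sub>i) * (-D)\<^sup>k \<psi> \<xi>\<close> with \<open>k = card I\<close> and \<open>\<xi>\<close> tending to \<open>T\<close> from the right; convexity gives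
  \<open>h\<^sub>i / s \<rightarrow> \<bar>\<phi>'(1)\<bar> x\<^sub>i\<close>. The slope \<open>\<phi>'(1)\<close> is nonzero because a bounded \<open>k\<close>-th derivative near
  \<open>0\<close> forces a bounded first one, so \<open>\<psi>\<close> is Lipschitz at \<open>0\<close>.\<close>

section \<open>Alternating differences and derivative bounds on the half-line\<close>

definition alternating_diff ::
    "('i \<Rightarrow> real) \<Rightarrow> 'i set \<Rightarrow> (real \<Rightarrow> real) \<Rightarrow> real \<Rightarrow> real" where
  "alternating_diff h I f t = (\<Sum>J\<in>Pow I. (-1) ^ card J * f (t + sum h J))"

lemma alternating_diff_empty [simp]: "alternating_diff h {} f t = f t"
  by (simp add: alternating_diff_def)

text \<open>The subsets of \<open>insert i I\<close> split by membership of \<open>i\<close>; those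
  containing \<open>i\<close> carry one more sign and the shift \<open>h i\<close>. Both the mean
  value theorem and the inclusion-exclusion below run on this recursion.\<close>

lemma alternating_diff_insert:
  assumes "finite I" "i \<notin> I"
  shows "alternating_diff h (insert i I) f t =
    alternating_diff h I f t - alternating_diff h I f (t + h i)"
proof -
  have fin: "finite J" if "J \<in> Pow I" for J
    using assms that by (auto intro: finite_subset)
  have inj: "inj_on (insert i) (Pow I)"
    using assms by (auto simp: inj_on_def)
  have "(\<Sum>J\<in>insert i ` Pow I. (-1) ^ card J * f (t + sum h J)) =
      (\<Sum>J\<in>Pow I. (-1) ^ card (insert i J) * f (t + sum h (insert i J)))"
    by (simp add: sum.reindex[OF inj])
  also have "\<dots> = (\<Sum>J\<in>Pow I. - ((-1) ^ card J * f (t + h i + sum h J)))"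
  proof (rule sum.cong[OF refl])
    fix J assume J: "J \<in> Pow I"
    then have "i \<notin> J" using assms by auto
    then show "(-1) ^ card (insert i J) * f (t + sum h (insert i J)) =
        - ((-1) ^ card J * f (t + h i + sum h J))"
      using fin[OF J] by (simp add: add.assoc)
  qed
  finally have "(\<Sum>J\<in>insert i ` Pow I. (-1) ^ card J * f (t + sum h J)) =
      - alternating_diff h I f (t + h i)"
    by (simp add: alternating_diff_def sum_negf)
  moreover have "Pow I \<inter> insert i ` Pow I = {}"
    using assms by auto
  ultimately show ?thesis
    using assms by (simp add: alternating_diff_def Pow_insert sum.union_disjoint)
qed

lemma alternating_diff_shift:
  "alternating_diff h I (\<lambda>s. f s - f (s + c)) t =
    alternating_diff h I f t - alternating_diff h I f (t + c)"
  by (simp add: alternating_diff_def right_diff_distrib sum_subtractf algebra_simps)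

text \<open>Derivatives are only required strictly to the right of \<open>T\<close>, so that \<open>T = 0\<close> is
  covered for functions on the half-line.\<close>

lemma alternating_diff_mean_value:
  assumes "finite I" "I \<noteq> {}" "\<And>i. i \<in> I \<Longrightarrow> 0 < h i"
    and "continuous_on {T..} (F 0)"
    and "\<And>j t. j < card I \<Longrightarrow> T < t \<Longrightarrow> (F j has_real_derivative - F (Suc j) t) (at t)"
  shows "\<exists>\<xi>. T < \<xi> \<and> \<xi> < T + sum h I \<and>
    alternating_diff h I (F 0) T = prod h I * F (card I) \<xi>"
  using assms
proof (induction I arbitrary: F rule: finite_ne_induct)
  case (singleton i)
  have "0 < h i" using singleton by simp
  \<comment> \<open>Here the endpoint \<open>T\<close> itself occurs, where no derivative is
    assumed; hence \<open>mvt\<close>, which asks only for continuity there, instead of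
    \<open>MVT2\<close>.\<close>
  have "\<exists>\<xi>>T. \<xi> < T + h i \<and> F 0 (T + h i) - F 0 T = (T + h i - T) * - F 1 \<xi>"
  proof (rule mvt[of T "T + h i" "F 0" "\<lambda>x. (*) (- F 1 x)"])
    show "continuous_on {T..T + h i} (F 0)"
      using singleton by (auto intro: continuous_on_subset)
    show "(F 0 has_derivative (*) (- F 1 x)) (at x)" if "T < x" for x
      using singleton(3)[of 0 x] that by (simp add: has_field_derivative_def)
  qed (use \<open>0 < h i\<close> in \<open>auto simp: mult.commute\<close>)
  then show ?case
    by (auto simp: alternating_diff_insert[of "{}" i, simplified] algebra_simps)
next
  case (insert i I)
  \<comment> \<open>The difference in direction \<open>i\<close> is absorbed into the function.
    \<open>G\<close> is again a chain of derivatives, so the induction hypothesis leaves a single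
    difference of \<open>F (card I)\<close>, and one ordinary mean value step supplies the factor
    \<open>h i\<close> and the last derivative.\<close>
  define G where "G j t = F j t - F j (t + h i)" for j t
  have hi: "0 < h i" using insert by simp
  have "\<exists>\<xi>. T < \<xi> \<and> \<xi> < T + sum h I \<and>
    alternating_diff h I (G 0) T = prod h I * G (card I) \<xi>"
  proof (rule insert.IH)
    show "continuous_on {T..} (G 0)"
      unfolding G_def using hi
      by (auto intro!: continuous_intros continuous_on_compose2[OF insert.prems(2)]
          insert.prems(2))
    show "(G j has_real_derivative - G (Suc j) t) (at t)" if "j < card I" "T < t" for j t
    proof -
      have j: "j < card (insert i I)" using that insert.hyps by simp
      have "((\<lambda>t. F j (t + h i)) has_real_derivative - F (Suc j) (t + h i)) (at t)"
        using insert.prems(3)[OF j, of "t + h i"] that hi by (simp add: DERIV_shift)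
      from DERIV_diff[OF insert.prems(3)[OF j that(2)] this] show ?thesis
        by (simp add: G_def[abs_def])
    qed
  qed (use insert.prems in auto)
  then obtain \<xi> where \<xi>: "T < \<xi>" "\<xi> < T + sum h I"
      "alternating_diff h I (G 0) T = prod h I * G (card I) \<xi>"
    by blast
  have "\<exists>\<zeta>>\<xi>. \<zeta> < \<xi> + h i \<and>
      F (card I) (\<xi> + h i) - F (card I) \<xi> = (\<xi> + h i - \<xi>) * - F (Suc (card I)) \<zeta>"
    using insert.prems(3) insert.hyps \<xi> hi by (intro MVT2) auto
  then obtain \<zeta> where \<zeta>: "\<xi> < \<zeta>" "\<zeta> < \<xi> + h i" "G (card I) \<xi> = h i * F (Suc (card I)) \<zeta>"
    by (auto simp: G_def)
  have "alternating_diff h (insert i I) (F 0) T = alternating_diff h I (G 0) T"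
    using insert.hyps by (simp add: alternating_diff_insert alternating_diff_shift G_def[abs_def])
  then show ?case
    using \<xi> \<zeta> insert.hyps by (intro exI[of _ \<zeta>]) simp
qed

text \<open>Descending from order \<open>k\<close>: on an interval of length at most
  \<open>\<delta>\<close>, \<open>F j\<close> differs from \<open>F j \<delta>\<close> by at most
  \<open>\<delta>\<close> times the bound on \<open>F (Suc j)\<close>.\<close>

lemma bounded_lower_derivatives_at_0:
  fixes F :: "nat \<Rightarrow> real \<Rightarrow> real"
  assumes der: "\<And>j t. j < k \<Longrightarrow> 0 < t \<Longrightarrow> (F j has_real_derivative - F (Suc j) t) (at t)"
    and "\<And>t. 0 < t \<Longrightarrow> t \<le> \<delta> \<Longrightarrow> \<bar>F k t\<bar> \<le> B"
    and "0 < \<delta>" "i \<le> k"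
  shows "\<exists>B. \<forall>t. 0 < t \<longrightarrow> t \<le> \<delta> \<longrightarrow> \<bar>F i t\<bar> \<le> B"
  using \<open>i \<le> k\<close>
proof (induction rule: inc_induct)
  case base
  then show ?case using assms by blast
next
  case (step j)
  then obtain B where B: "\<And>t. 0 < t \<Longrightarrow> t \<le> \<delta> \<Longrightarrow> \<bar>F (Suc j) t\<bar> \<le> B" by blast
  have "\<bar>F j t\<bar> \<le> \<bar>F j \<delta>\<bar> + B * \<delta>" if t: "0 < t" "t \<le> \<delta>" for t
  proof -
    have "norm (F j t - F j \<delta>) \<le> B * norm (t - \<delta>)"
    proof (rule field_differentiable_bound[where S = "{t..\<delta>}"])
      show "(F j has_field_derivative - F (Suc j) z) (at z within {t..\<delta>})" if "z \<in> {t..\<delta>}" for z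
        using der[OF step(2), of z] that t by (auto intro: has_field_derivative_at_within)
    qed (use t B in auto)
    moreover have "B * norm (t - \<delta>) \<le> B * \<delta>"
      using t B[of t] by (intro mult_left_mono) auto
    ultimately show ?thesis by simp
  qed
  then show ?case by blast
qed

section \<open>The generalized inverse and the uniform margins\<close>

lemma gen_inverse_antimono:
  assumes "\<phi> 1 = 0" "y \<le> z"
  shows "gen_inverse \<phi> z \<le> gen_inverse \<phi> y"
  unfolding gen_inverse_def
proof (rule cInf_superset_mono)
  show "{t \<in> {0..1}. \<phi> t \<le> y} \<noteq> {}"
    using assms(1) by (auto intro!: exI[of _ 1])
  show "bdd_below {t \<in> {0..1}. \<phi> t \<le> z}"
    by (auto intro!: bdd_belowI[of _ 0])
qed (use assms in auto)

lemma archimedean_copula_margin: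
  fixes i :: "'d::finite"
  assumes "\<phi> 1 = 0"
  shows "archimedean_copula \<phi> (\<chi> j. if j = i then u else 1) = gen_inverse \<phi> (\<phi> u)"
proof -
  have "(\<Sum>j\<in>UNIV. \<phi> (if j = i then u else 1)) = (\<Sum>j\<in>UNIV. if j = i then \<phi> u else 0)"
    using assms by (intro sum.cong) auto
  then show ?thesis by (simp add: archimedean_copula_def)
qed

text \<open>Setting all coordinates but one to 1 turns the copula into
  \<open>gen_inverse \<phi> (\<phi> u)\<close>, and this margin is uniform. The copula hypothesis
  enters the final proof through this identity.\<close>

lemma gen_inverse_generator:
  fixes \<phi> :: "real \<Rightarrow> ennreal"
  assumes "is_copula (archimedean_copula \<phi> :: real ^ 'd \<Rightarrow> real)" "\<phi> 1 = 0" "u \<in> {0..1}"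
  shows "gen_inverse \<phi> (\<phi> u) = u"
proof -
  obtain N :: "(real ^ 'd) measure" where N: "prob_space N" "sets N = sets borel"
    "has_df_on_cube N (archimedean_copula \<phi>)"
    "\<And>i. distr N borel (\<lambda>x. x $ i) = uniform_measure lborel {0<..<1}"
    using assms(1) by (auto simp: is_copula_def)
  interpret N: prob_space N by fact
  have [measurable]: "(\<lambda>x. x $ j) \<in> N \<rightarrow>\<^sub>M (borel :: real measure)" for j
    unfolding measurable_cong_sets[OF N(2) refl]
    by (intro borel_measurable_continuous_onI continuous_intros)
  have margin: "measure N {x \<in> space N. x $ j \<le> t} = t" if "t \<in> {0..1}" for j t
  proof -
    have "measure N {x \<in> space N. x $ j \<le> t} = measure (distr N borel (\<lambda>x. x $ j)) {..t}"
      by (subst measure_distr) (auto intro!: arg_cong[where f = "measure N"])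
    also have "\<dots> = measure lborel ({0<..<1} \<inter> {..t})"
      unfolding N(4) by (subst measure_uniform_measure) auto
    also have "measure lborel ({0<..<1} \<inter> {..t}) = t"
    proof (cases "t = 1")
      case True
      then have "{0<..<1} \<inter> {..t} = {0<..<1}" by auto
      then show ?thesis using True by simp
    next
      case False
      then have "{0<..<1} \<inter> {..t} = {0<..t}" using that by auto
      then show ?thesis using that by simp
    qed
    finally show ?thesis .
  qed
  have le1: "AE x in N. x $ j \<le> 1" for j
    by (rule N.AE_prob_1[THEN AE_mp]) (use margin[of 1 j] in auto)
  fix i :: 'd
  let ?v = "(\<chi> j. if j = i then u else 1) :: real ^ 'd"
  have "?v \<in> {0..1}"
    using assms(3) by (auto simp: less_eq_vec_def)
  then have "measure N {..?v} = gen_inverse \<phi> (\<phi> u)"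
    using N(3) archimedean_copula_margin[of \<phi> i u, OF assms(2)]
    by (auto simp: has_df_on_cube_def)
  \<comment> \<open>The orthant also demands \<open>x $ j \<le> 1\<close> for the other
    \<open>j\<close>, which holds almost surely.\<close>
  moreover have "measure N {..?v} = measure N {x \<in> space N. x $ i \<le> u}"
  proof (rule N.finite_measure_eq_AE)
    have "AE x in N. \<forall>j. x $ j \<le> 1"
      using le1 by (simp add: AE_all_countable)
    then show "AE x in N. (x \<in> {..?v}) = (x \<in> {x \<in> space N. x $ i \<le> u})"
      by (rule AE_mp) (auto simp: less_eq_vec_def)
  qed (use N(2) in auto)
  ultimately show ?thesis using margin[of u i] assms(3) by simp
qed

lemma measure_df:
  fixes U :: "'a \<Rightarrow> real ^ 'd"
  assumes "U \<in> borel_measurable M" "has_df_on_cube (distr M borel U) C"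
    and "\<And>i. 0 \<le> y i \<and> y i \<le> 1"
  shows "measure M {\<omega> \<in> space M. \<forall>i. U \<omega> $ i \<le> y i} = C (\<chi> i. y i)"
proof -
  have "(\<chi> i. y i) \<in> {0..1}" using assms(3) by (auto simp: less_eq_vec_def)
  then have "C (\<chi> i. y i) = measure (distr M borel U) {..\<chi> i. y i}"
    using assms(2) by (auto simp: has_df_on_cube_def)
  also have "\<dots> = measure M {\<omega> \<in> space M. \<forall>i. U \<omega> $ i \<le> y i}"
    using assms(1)
    by (subst measure_distr) (auto intro!: arg_cong[where f = "measure M"] simp: less_eq_vec_def)
  finally show ?thesis by simp
qed

section \<open>Generators with \<open>gen_inverse\<close> as a left inverse\<close>

context
  fixes \<phi> :: "real \<Rightarrow> ennreal"
  assumes gen: "archimedean_generator \<phi>"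
    and inv: "\<And>u. u \<in> {0..1} \<Longrightarrow> gen_inverse \<phi> (\<phi> u) = u"
begin

lemma generator_1: "\<phi> 1 = 0"
  using gen by (simp add: archimedean_generator_def)

text \<open>An infinite value at \<open>u\<close> would recur at \<open>u / 2\<close> by
  monotonicity, and a left inverse cannot separate equal values. The same injectivity gives
  \<open>generator_pos\<close>.\<close>

lemma generator_finite:
  assumes "0 < u" "u \<le> 1"
  shows "\<phi> u < \<infinity>"
proof (rule ccontr)
  assume "\<not> \<phi> u < \<infinity>"
  then have "\<phi> u = \<infinity>" by (simp add: less_top[symmetric])
  moreover have "\<phi> u \<le> \<phi> (u / 2)"
    using gen assms by (auto simp: archimedean_generator_def monotone_on_def)
  ultimately have "\<phi> (u / 2) = \<phi> u" by (simp add: top_unique)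
  then show False using inv[of u] inv[of "u / 2"] assms by auto
qed

lemma ennreal_generator:
  assumes "0 < u" "u \<le> 1"
  shows "ennreal (enn2real (\<phi> u)) = \<phi> u"
  using generator_finite[OF assms] by simp

lemma generator_pos:
  assumes "0 < u" "u < 1"
  shows "0 < enn2real (\<phi> u)"
proof -
  have "\<phi> u \<noteq> \<phi> 1" using inv[of u] inv[of 1] assms by auto
  then show ?thesis
    using generator_finite[of u] generator_1 assms
    by (auto simp: enn2real_positive_iff less_top zero_less_iff_neq_zero)
qed

text \<open>\<open>1 - s\<close> lies between 1 and \<open>1 - t\<close> with weight
  \<open>s / t\<close>, so by convexity the chord slopes from 1 increase with \<open>s\<close>.
  Being nonnegative, they converge to their infimum.\<close>

lemma generator_slope_limit:
  "\<exists>m. ((\<lambda>s. enn2real (\<phi> (1 - s)) / s) \<longlongrightarrow> m) (at_right 0)"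
proof -
  let ?g = "\<lambda>s. enn2real (\<phi> (1 - s)) / s"
  \<comment> \<open>Arguments stay below 1, since \<open>\<phi> 0\<close> may be infinite and
    \<open>enn2real\<close> would send it to 0.\<close>
  have mono: "?g s \<le> ?g t" if st: "s \<in> {..<1}" "t \<in> {..<1}" "0 < s" "s \<le> t" for s t
  proof -
    define a where "a = s / t"
    have a: "0 \<le> a" "a \<le> 1" "s = a * t" using st by (auto simp: a_def)
    have "\<phi> ((1 - a) * 1 + a * (1 - t)) \<le> ennreal (1 - a) * \<phi> 1 + ennreal a * \<phi> (1 - t)"
      using gen a st unfolding archimedean_generator_def
      by (elim conjE) (drule bspec[of _ _ 1], simp, drule bspec[of _ _ "1 - t"], simp, simp)
    also have "(1 - a) * 1 + a * (1 - t) = 1 - s"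
      by (simp add: a algebra_simps)
    finally have "\<phi> (1 - s) \<le> ennreal (a * enn2real (\<phi> (1 - t)))"
      using a st by (simp add: generator_1 ennreal_mult ennreal_generator)
    then have "enn2real (\<phi> (1 - s)) \<le> a * enn2real (\<phi> (1 - t))"
      using a by (intro enn2real_leI) auto
    then show ?thesis using st by (simp add: a_def field_simps)
  qed
  have "(?g \<longlongrightarrow> Inf (?g ` ({0<..} \<inter> {..<1}))) (at 0 within ({0<..} \<inter> {..<1}))"
    by (rule Lim_right_bound[where K = 0]) (use mono in auto)
  moreover have "at 0 within ({0<..} \<inter> {..<1}) = at_right (0::real)"
    by (rule at_within_nhd[of _ "{..<1}"]) auto
  ultimately show ?thesis by auto
qed

text \<open>Inserting \<open>t = \<phi> (1 - s)\<close> into the linear bound gives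
  \<open>s \<le> K * \<phi> (1 - s)\<close>. Dividing by \<open>s\<close> and letting it tend to 0
  yields \<open>1 \<le> K * m\<close>, which excludes \<open>m = 0\<close>.\<close>

lemma generator_slope_pos:
  assumes K: "\<And>t. 0 < t \<Longrightarrow> t \<le> \<delta> \<Longrightarrow> 1 - gen_inverse_real \<phi> t \<le> K * t" and "0 < \<delta>"
    and m: "((\<lambda>s. enn2real (\<phi> (1 - s)) / s) \<longlongrightarrow> m) (at_right 0)"
  shows "0 < m"
proof -
  let ?p = "\<lambda>s. enn2real (\<phi> (1 - s))"
  have ev: "eventually (\<lambda>s::real. s \<in> {0<..<1}) (at_right 0)"
    by (rule eventually_at_right_real) simp
  \<comment> \<open>A finite slope makes the generator continuous at 1, so \<open>?p s\<close>
    eventually falls in the range where the bound \<open>K\<close> applies.\<close>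
  have lim0: "(?p \<longlongrightarrow> 0) (at_right 0)"
  proof (rule Lim_transform_eventually)
    show "((\<lambda>s. ?p s / s * s) \<longlongrightarrow> 0) (at_right 0)"
      by (rule tendsto_eq_intros m tendsto_ident_at | simp)+
    show "\<forall>\<^sub>F s in at_right 0. ?p s / s * s = ?p s"
      using ev by eventually_elim auto
  qed
  have "eventually (\<lambda>s. ?p s < \<delta>) (at_right 0)"
    using lim0 \<open>0 < \<delta>\<close> by (rule order_tendstoD)
  with ev have ineq: "eventually (\<lambda>s. s \<in> {0<..<1} \<and> s \<le> K * ?p s) (at_right 0)"
  proof eventually_elim
    case (elim s)
    then have "1 - gen_inverse_real \<phi> (?p s) \<le> K * ?p s"
      using generator_pos[of "1 - s"] by (intro K) auto
    then show ?case
      using elim inv[of "1 - s"] by (simp add: gen_inverse_real_def ennreal_generator)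
  qed
  have "1 \<le> K * m"
  proof (rule tendsto_lowerbound)
    show "((\<lambda>s. K * (?p s / s)) \<longlongrightarrow> K * m) (at_right 0)"
      by (intro tendsto_intros m)
    show "\<forall>\<^sub>F s in at_right 0. 1 \<le> K * (?p s / s)"
      using ineq by eventually_elim (auto simp: field_simps)
  qed simp
  moreover have "0 \<le> m"
  proof (rule tendsto_lowerbound[OF m])
    show "\<forall>\<^sub>F s in at_right 0. 0 \<le> ?p s / s"
      using ev by eventually_elim auto
  qed simp
  ultimately show ?thesis by (cases "m = 0") auto
qed

lemma gen_inverse_real_0: "gen_inverse_real \<phi> 0 = 1"
  using inv[of 1] by (simp add: gen_inverse_real_def generator_1)

lemma gen_inverse_real_tendsto_1: "(gen_inverse_real \<phi> \<longlongrightarrow> 1) (at_right 0)"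
proof (rule order_tendstoI)
  fix c :: real assume "1 < c"
  have "gen_inverse_real \<phi> t \<le> 1" for t
    using gen_inverse_antimono[of \<phi> 0 "ennreal t"] gen_inverse_real_0
    by (simp add: gen_inverse_real_def generator_1)
  then show "\<forall>\<^sub>F t in at_right 0. gen_inverse_real \<phi> t < c"
    using \<open>1 < c\<close> by (intro always_eventually) (auto intro: le_less_trans)
next
  fix c :: real assume c: "c < 1"
  \<comment> \<open>Above \<open>c\<close> and inside (0,1), where \<open>\<phi> u\<close> is
    positive and finite; below \<open>\<phi> u\<close> antitonicity keeps the inverse at least
    \<open>u\<close>.\<close>
  define u where "u = (1 + max c 0) / 2"
  have u: "0 < u" "u < 1" "c < u" using c by (auto simp: u_def)
  have "eventually (\<lambda>t. t \<in> {0<..<enn2real (\<phi> u)}) (at_right 0)"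
    using generator_pos[of u] u by (intro eventually_at_right_real) auto
  then show "\<forall>\<^sub>F t in at_right 0. c < gen_inverse_real \<phi> t"
  proof eventually_elim
    case (elim t)
    then have "ennreal t \<le> \<phi> u"
      using ennreal_generator[of u] u by (metis ennreal_leI greaterThanLessThan_iff less_imp_le)
    then have "gen_inverse \<phi> (\<phi> u) \<le> gen_inverse_real \<phi> t"
      using generator_1 by (simp add: gen_inverse_real_def gen_inverse_antimono)
    then show ?case using inv[of u] u by simp
  qed
qed

section \<open>Box probabilities as alternating differences\<close>

text \<open>The distribution function is prescribed only on the cube, so mass beyond 1 and atoms are
  excluded by hand: the orthant at the all-ones vector has mass 1, and the event
  \<open>U \<omega> $ i = a\<close> has mass at most \<open>a - b\<close> for every \<open>b\<close>
  in (0,a).\<close>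

lemma
  fixes U :: "'a \<Rightarrow> real ^ 'd"
  assumes "prob_space M" and U [measurable]: "U \<in> borel_measurable M"
    and df: "has_df_on_cube (distr M borel U) (archimedean_copula \<phi>)"
  shows AE_le_1: "AE \<omega> in M. \<forall>i. U \<omega> $ i \<le> 1"
    and AE_neq: "0 < a \<Longrightarrow> a < 1 \<Longrightarrow> AE \<omega> in M. U \<omega> $ i \<noteq> a"
proof -
  interpret prob_space M by fact
  have [measurable]: "(\<lambda>\<omega>. U \<omega> $ i) \<in> borel_measurable M" for i
    by (rule measurable_compose[OF U])
      (intro borel_measurable_continuous_onI continuous_intros)
  let ?W = "\<lambda>i b. {\<omega> \<in> space M. \<forall>j. U \<omega> $ j \<le> (if j = i then b else 1)}"
  have W: "prob (?W i b) = b" if "0 \<le> b" "b \<le> 1" for b i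
    using measure_df[OF U df, of "\<lambda>j. if j = i then b else 1"] that
      archimedean_copula_margin[of \<phi> i b] generator_1 inv[of b] by auto
  show le: "AE \<omega> in M. \<forall>i. U \<omega> $ i \<le> 1"
    \<comment> \<open>With \<open>b = 1\<close> both branches in \<open>?W\<close> agree, so any
      index serves.\<close>
    using AE_prob_1[OF W[of 1 undefined]] by (auto cong: if_cong)
  assume a: "0 < a" "a < 1"
  let ?E = "{\<omega> \<in> space M. U \<omega> $ i = a}"
  have "prob ?E \<le> a - b" if b: "b \<in> {0<..<a}" for b
  proof -
    have "prob ?E \<le> prob (?W i a - ?W i b)"
    proof (rule finite_measure_mono_AE)
      show "AE \<omega> in M. \<omega> \<in> ?E \<longrightarrow> \<omega> \<in> ?W i a - ?W i b"
        using le by eventually_elim (use b in auto)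
    qed measurable
    also have "\<dots> = prob (?W i a) - prob (?W i b)"
    proof (rule finite_measure_Diff)
      show "?W i b \<subseteq> ?W i a" using b by (fastforce split: if_splits)
    qed simp_all
    finally show ?thesis using W[of a i] W[of b i] a b by simp
  qed
  \<comment> \<open>If \<open>prob ?E\<close> were positive, this \<open>b\<close> would lie in
    (0,a) with \<open>a - b\<close> at most half of \<open>prob ?E\<close>.\<close>
  from this[of "a - min a (prob ?E) / 2"] have "\<not> 0 < prob ?E"
    using a by (cases "a \<le> prob ?E") (auto simp: min_def)
  then have "?E \<in> null_sets M"
    by (intro null_setsI) (auto simp: emeasure_eq_measure zero_less_measure_iff)
  then show "AE \<omega> in M. U \<omega> $ i \<noteq> a"
    by (rule AE_I') auto
qed

text \<open>A lower bound at \<open>i\<close> is a difference of two upper bounds, at 1 and at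
  \<open>a i\<close>, which add 0 and \<open>\<phi> (a i)\<close> to the argument of the inverse. By
  the two preceding facts the bound 1 and the boundary \<open>U \<omega> $ i = a i\<close> matter
  only on null sets. Induction needs \<open>y\<close> arbitrary, since \<open>i\<close> joins the
  upper-bounded coordinates.\<close>

lemma measure_box_eq_alternating_diff:
  fixes U :: "'a \<Rightarrow> real ^ 'd" and a y :: "'d \<Rightarrow> real"
  assumes "prob_space M" and U [measurable]: "U \<in> borel_measurable M"
    and df: "has_df_on_cube (distr M borel U) (archimedean_copula \<phi>)"
    and "\<And>i. i \<in> I \<Longrightarrow> 0 < a i \<and> a i < 1" "\<And>i. i \<notin> I \<Longrightarrow> 0 < y i \<and> y i \<le> 1"
  shows "measure M {\<omega> \<in> space M. (\<forall>i\<in>I. a i \<le> U \<omega> $ i) \<and> (\<forall>i\<in>-I. U \<omega> $ i \<le> y i)} =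
    alternating_diff (\<lambda>i. enn2real (\<phi> (a i))) I (gen_inverse_real \<phi>)
      (\<Sum>i\<in>-I. enn2real (\<phi> (y i)))"
  using finite[of I] assms(4,5)
proof (induction I arbitrary: y rule: finite_induct)
  case empty
  have "(\<Sum>i\<in>UNIV. \<phi> (y i)) = ennreal (\<Sum>i\<in>UNIV. enn2real (\<phi> (y i)))"
    using empty by (subst sum_ennreal[symmetric]) (auto simp: ennreal_generator)
  then show ?case
    using measure_df[OF U df, of y] empty
    by (simp add: archimedean_copula_def gen_inverse_real_def less_imp_le)
next
  case (insert i I)
  interpret prob_space M by fact
  have [measurable]: "(\<lambda>\<omega>. U \<omega> $ i) \<in> borel_measurable M" for i
    by (rule measurable_compose[OF U])
      (intro borel_measurable_continuous_onI continuous_intros)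
  let ?E = "\<lambda>I y. {\<omega> \<in> space M. (\<forall>i\<in>I. a i \<le> U \<omega> $ i) \<and> (\<forall>i\<in>-I. U \<omega> $ i \<le> y i)}"
  let ?p = "\<lambda>u. enn2real (\<phi> u)"
  have ai: "0 < a i" "a i < 1" using insert.prems by auto
  have "-I = insert i (- insert i I)" using insert.hyps by auto
  then have compl: "(\<Sum>j\<in>-I. ?p ((y(i := c)) j)) = (\<Sum>j\<in>-insert i I. ?p (y j)) + ?p c" for c
    by (auto simp: add.commute intro!: sum.cong)
  have IH: "prob (?E I (y(i := c))) = alternating_diff (\<lambda>i. ?p (a i)) I (gen_inverse_real \<phi>)
      ((\<Sum>j\<in>-insert i I. ?p (y j)) + ?p c)" if "0 < c" "c \<le> 1" for c
    unfolding compl[symmetric] using insert.prems that by (intro insert.IH) auto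
  have "prob (?E (insert i I) y) = prob (?E I (y(i := 1)) - ?E I (y(i := a i)))"
  proof (rule finite_measure_eq_AE)
    have "AE \<omega> in M. \<forall>i. U \<omega> $ i \<le> 1" by (rule AE_le_1[OF assms(1) U df])
    moreover have "AE \<omega> in M. U \<omega> $ i \<noteq> a i" by (rule AE_neq[OF assms(1) U df ai])
    ultimately
    show "AE \<omega> in M. (\<omega> \<in> ?E (insert i I) y) = (\<omega> \<in> ?E I (y(i := 1)) - ?E I (y(i := a i)))"
      by eventually_elim (use insert.hyps(2) in \<open>auto simp: not_le order.order_iff_strict\<close>)
  qed measurable
  also have "\<dots> = prob (?E I (y(i := 1))) - prob (?E I (y(i := a i)))"
  proof (rule finite_measure_Diff)
    show "?E I (y(i := a i)) \<subseteq> ?E I (y(i := 1))"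
      using ai by (auto split: if_splits)
  qed measurable
  also have "\<dots> = alternating_diff (\<lambda>i. ?p (a i)) (insert i I) (gen_inverse_real \<phi>)
      (\<Sum>j\<in>-insert i I. ?p (y j))"
    using ai insert.hyps
    by (simp add: IH generator_1 alternating_diff_insert del: fun_upd_apply)
  finally show ?case .
qed

end

section \<open>The scaled limit\<close>

theorem theorem4p3:
  fixes \<phi> :: "real \<Rightarrow> ennreal"
    and M :: "'a measure"
    and U :: "'a \<Rightarrow> real ^ 'd"
    and I :: "'d set"
  assumes "CARD('d) \<ge> 2"
    and "archimedean_generator \<phi>"
    and "is_copula (archimedean_copula \<phi> :: real ^ 'd \<Rightarrow> real)"
    and "prob_space M"
    and "U \<in> borel_measurable M"
    and "has_df_on_cube (distr M borel U) (archimedean_copula \<phi>)"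
    and "I \<noteq> {}"
    and "cont_diff_on_pos (card I) (gen_inverse_real \<phi>)"
    and "\<exists>L::real. ((minus_D ^^ card I) (gen_inverse_real \<phi>) \<longlongrightarrow> L) (at_right 0)"
  shows "generator_deriv_1 \<phi> < 0 \<and>
    (\<forall>x y :: 'd \<Rightarrow> real.
       (\<forall>i\<in>I. 0 < x i) \<longrightarrow> (\<forall>i\<in>-I. 0 < y i \<and> y i \<le> 1) \<longrightarrow>
       ((\<lambda>s. measure M {\<omega> \<in> space M. (\<forall>i\<in>I. U \<omega> $ i \<ge> 1 - s * x i) \<and>
                                      (\<forall>i\<in>-I. U \<omega> $ i \<le> y i)} / s ^ card I)
         \<longlongrightarrow> \<bar>generator_deriv_1 \<phi>\<bar> ^ card I * (\<Prod>i\<in>I. x i) *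
             minus_D_pow (card I) (gen_inverse_real \<phi>) (enn2real (\<Sum>i\<in>-I. \<phi> (y i))))
       (at_right 0))"
proof -
  define \<psi> where "\<psi> = gen_inverse_real \<phi>"
  define k where "k = card I"
  define F where "F j = (minus_D ^^ j) \<psi>" for j
  define p where "p u = enn2real (\<phi> u)" for u
  have "\<phi> 1 = 0" using assms(2) by (simp add: archimedean_generator_def)
  note inv = gen_inverse_generator[OF assms(3) this]
  note gen = assms(2)
  obtain L where L: "(F k \<longlongrightarrow> L) (at_right 0)"
    using assms(9) by (auto simp: F_def k_def \<psi>_def)
  have "0 < k" using assms(7) by (simp add: k_def card_gt_0_iff)
  have der: "(F j has_real_derivative - F (Suc j) t) (at t)" if "j < k" "0 < t" for j t
    using assms(8) that
    by (simp add: cont_diff_on_pos_def F_def k_def \<psi>_def minus_D_def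
        DERIV_deriv_iff_real_differentiable)
  have F0: "F 0 = \<psi>" by (simp add: F_def)
  have cont: "continuous_on {0..} \<psi>"
    unfolding continuous_on_eq_continuous_within
  proof
    fix t :: real assume "t \<in> {0..}"
    show "continuous (at t within {0..}) \<psi>"
    proof (cases "t = 0")
      case True
      have "at (0::real) within {0..} = at_right 0"
        by (rule at_within_Ici_at_right)
      then show ?thesis
        using gen_inverse_real_tendsto_1[OF gen inv] gen_inverse_real_0[OF gen inv] True
        by (simp add: continuous_within \<psi>_def)
    next
      case False
      then show ?thesis
        using der[of 0 t] \<open>0 < k\<close> \<open>t \<in> {0..}\<close> F0
        by (auto intro: continuous_at_imp_continuous_at_within DERIV_isCont)
    qed
  qed
  obtain m where m: "((\<lambda>s. p (1 - s) / s) \<longlongrightarrow> m) (at_right 0)"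
    using generator_slope_limit[OF gen inv] by (auto simp: p_def)
  \<comment> \<open>The limit \<open>L\<close> bounds \<open>F k\<close> near 0, hence also
    \<open>F 1\<close>; this gives the linear bound required by
    \<open>generator_slope_pos\<close>.\<close>
  have "0 < m"
  proof -
    have "eventually (\<lambda>t. \<bar>F k t\<bar> < \<bar>L\<bar> + 1) (at_right 0)"
      by (rule order_tendstoD(2)[OF tendsto_rabs[OF L]]) simp
    then obtain d where d: "0 < d" "\<And>t. 0 < t \<Longrightarrow> t < d \<Longrightarrow> \<bar>F k t\<bar> < \<bar>L\<bar> + 1"
      by (auto simp: eventually_at_right_field)
    have "\<exists>B. \<forall>t. 0 < t \<longrightarrow> t \<le> d / 2 \<longrightarrow> \<bar>F 1 t\<bar> \<le> B"
      by (rule bounded_lower_derivatives_at_0[where k = k and B = "\<bar>L\<bar> + 1"])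
        (use der d \<open>0 < k\<close> in \<open>auto intro!: less_imp_le[OF d(2)]\<close>)
    then obtain B where B: "\<And>t. 0 < t \<Longrightarrow> t \<le> d / 2 \<Longrightarrow> \<bar>F 1 t\<bar> \<le> B" by blast
    have "1 - \<psi> t \<le> B * t" if t: "0 < t" "t \<le> d / 2" for t
    proof -
      \<comment> \<open>A one-point index set makes the alternating difference
        \<open>\<psi> 0 - \<psi> t\<close>, giving a mean value theorem without a derivative at
        0.\<close>
      obtain \<xi> where \<xi>: "0 < \<xi>" "\<xi> < t"
          "alternating_diff (\<lambda>_. t) {()} (F 0) 0 = t * F 1 \<xi>"
        using alternating_diff_mean_value[of "{()}" "\<lambda>_. t" 0 F] t cont der \<open>0 < k\<close> F0 by auto
      then have "1 - \<psi> t = t * F 1 \<xi>"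
        using gen_inverse_real_0[OF gen inv]
        by (simp add: F0 \<psi>_def alternating_diff_insert[of "{}" "()", simplified])
      also have "\<dots> \<le> t * B" using B[of \<xi>] \<xi> t by (intro mult_left_mono) auto
      finally show ?thesis by (simp add: mult.commute)
    qed
    then show ?thesis
      using m d(1) unfolding \<psi>_def p_def
      using generator_slope_pos[OF gen inv, of "d / 2" B m] by simp
  qed
  have deriv_1: "generator_deriv_1 \<phi> = - m"
    using tendsto_Lim[OF _ m] by (simp add: generator_deriv_1_def p_def)
  \<comment> \<open>One-sided continuity suffices because the intermediate points approach strictly
    from the right; at 0 it is the convention in \<open>minus_D_pow\<close>.\<close>
  have right_cont: "(F k \<longlongrightarrow> minus_D_pow k \<psi> t) (at_right t)" if "0 \<le> t" for t
  proof (cases "t = 0")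
    case True
    then show ?thesis using L tendsto_Lim[OF _ L] by (simp add: minus_D_pow_def F_def)
  next
    case False
    have "continuous_on {0<..} (F k)"
      using assms(8) by (simp add: cont_diff_on_pos_def F_def k_def \<psi>_def)
    then have "isCont (F k) t"
      using False that by (simp add: continuous_on_eq_continuous_at)
    then have "(F k \<longlongrightarrow> F k t) (at_right t)"
      by (auto simp: isCont_def intro: tendsto_within_subset)
    then show ?thesis using False by (simp add: minus_D_pow_def F_def)
  qed
  have "((\<lambda>s. measure M {\<omega> \<in> space M. (\<forall>i\<in>I. U \<omega> $ i \<ge> 1 - s * x i) \<and>
          (\<forall>i\<in>-I. U \<omega> $ i \<le> y i)} / s ^ k)
        \<longlongrightarrow> m ^ k * (\<Prod>i\<in>I. x i) * minus_D_pow k \<psi> (enn2real (\<Sum>i\<in>-I. \<phi> (y i))))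
      (at_right 0)"
    if x: "\<forall>i\<in>I. 0 < x i" and y: "\<forall>i\<in>-I. 0 < y i \<and> y i \<le> 1" for x y :: "'d \<Rightarrow> real"
  proof -
    define T where "T = (\<Sum>i\<in>-I. p (y i))"
    define h where "h s i = p (1 - s * x i)" for s i
    let ?P = "\<lambda>s. measure M {\<omega> \<in> space M. (\<forall>i\<in>I. U \<omega> $ i \<ge> 1 - s * x i) \<and>
          (\<forall>i\<in>-I. U \<omega> $ i \<le> y i)}"
    have "0 \<le> T" by (simp add: T_def p_def sum_nonneg)
    \<comment> \<open>Since \<open>y i\<close> is positive, every summand is finite, so
      \<open>enn2real\<close> commutes with the sum.\<close>
    have T: "enn2real (\<Sum>i\<in>-I. \<phi> (y i)) = T"
      unfolding T_def p_def
    proof (subst enn2real_sum)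
      show "\<phi> (y i) < top" if "i \<in> -I" for i
        using generator_finite[OF gen inv, of "y i"] y that by simp
    qed simp
    have h_slope: "((\<lambda>s. h s i / s) \<longlongrightarrow> m * x i) (at_right 0)" if "i \<in> I" for i
    proof (rule Lim_transform_eventually)
      have "filterlim (\<lambda>s. s * x i) (at_right 0) (at_right 0)"
        using x that
        by (intro filterlim_at_withinI tendsto_eq_intros)
          (auto intro!: eventually_mono[OF eventually_at_right_less[of 0]])
      from filterlim_compose[OF m this]
      show "((\<lambda>s. p (1 - s * x i) / (s * x i) * x i) \<longlongrightarrow> m * x i) (at_right 0)"
        by (intro tendsto_intros)
      show "\<forall>\<^sub>F s in at_right 0. p (1 - s * x i) / (s * x i) * x i = h s i / s"
        using x that by (intro always_eventually) (auto simp: h_def)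
    qed
    have small: "\<forall>\<^sub>F s in at_right 0. 0 < s \<and> (\<forall>i\<in>I. 0 < 1 - s * x i \<and> 1 - s * x i < 1)"
    proof -
      have "\<forall>\<^sub>F s in at_right 0. s * x i < 1" if "i \<in> I" for i
        by (rule order_tendstoD(2)[where y = 0]) (auto intro!: tendsto_eq_intros)
      then have "\<forall>\<^sub>F s in at_right 0. \<forall>i\<in>I. s * x i < 1"
        by (simp add: eventually_ball_finite)
      with eventually_at_right_less[of 0] show ?thesis
        by eventually_elim (use x in auto)
    qed
    have h_0: "((\<lambda>s. T + sum (h s) I) \<longlongrightarrow> T) (at_right 0)"
    proof -
      have "((\<lambda>s. T + (\<Sum>i\<in>I. h s i / s * s)) \<longlongrightarrow> T + (\<Sum>i\<in>I. m * x i * 0)) (at_right 0)"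
        by (intro tendsto_intros h_slope)
      moreover have "\<forall>\<^sub>F s in at_right 0. T + (\<Sum>i\<in>I. h s i / s * s) = T + sum (h s) I"
        using small by eventually_elim auto
      ultimately have "((\<lambda>s. T + sum (h s) I) \<longlongrightarrow> T + (\<Sum>i\<in>I. m * x i * 0)) (at_right 0)"
        by (rule Lim_transform_eventually)
      then show ?thesis by simp
    qed
    \<comment> \<open>The box probability is a product of \<open>k\<close> increments times
      \<open>F k \<xi>\<close>; dividing by \<open>s ^ k\<close> gives each increment its own
      \<open>s\<close>.\<close>
    have ex: "\<forall>\<^sub>F s in at_right 0. \<exists>\<xi>. T < \<xi> \<and> \<xi> < T + sum (h s) I \<and>
        ?P s / s ^ k = (\<Prod>i\<in>I. h s i / s) * F k \<xi>"
      using small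
    proof eventually_elim
      case (elim s)
      have "?P s = alternating_diff (h s) I (F 0) T"
        unfolding h_def T_def F0 \<psi>_def p_def
        by (rule measure_box_eq_alternating_diff[OF gen inv assms(4-6)]) (use elim y in auto)
      moreover have "\<exists>\<xi>. T < \<xi> \<and> \<xi> < T + sum (h s) I \<and>
          alternating_diff (h s) I (F 0) T = prod (h s) I * F (card I) \<xi>"
      proof (rule alternating_diff_mean_value)
        show "0 < h s i" if "i \<in> I" for i
          unfolding h_def p_def by (rule generator_pos[OF gen inv]) (use elim that in auto)
        show "continuous_on {T..} (F 0)"
          using cont \<open>0 \<le> T\<close> F0 by (auto intro: continuous_on_subset)
      qed (use assms(7) der \<open>0 \<le> T\<close> in \<open>auto simp: k_def\<close>)
      ultimately show ?case
        using elim by (auto simp: k_def prod_dividef)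
    qed
    \<comment> \<open>Choosing the intermediate point as a function of \<open>s\<close> allows it to
      be squeezed between \<open>T\<close> and \<open>T + sum (h s) I\<close>; strictness on the
      left yields convergence along \<open>at_right T\<close>.\<close>
    define \<xi> where "\<xi> s = (SOME \<xi>. T < \<xi> \<and> \<xi> < T + sum (h s) I \<and>
        ?P s / s ^ k = (\<Prod>i\<in>I. h s i / s) * F k \<xi>)" for s
    have \<xi>: "\<forall>\<^sub>F s in at_right 0. T < \<xi> s \<and> \<xi> s < T + sum (h s) I \<and>
        ?P s / s ^ k = (\<Prod>i\<in>I. h s i / s) * F k (\<xi> s)"
      using ex unfolding \<xi>_def by eventually_elim (rule someI_ex)
    have "(\<xi> \<longlongrightarrow> T) (at_right 0)"
      by (rule tendsto_sandwich[OF _ _ tendsto_const h_0]) (use \<xi> in \<open>auto elim: eventually_mono\<close>)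
    then have "filterlim \<xi> (at_right T) (at_right 0)"
      by (rule filterlim_at_withinI) (use \<xi> in \<open>auto elim: eventually_mono\<close>)
    from filterlim_compose[OF right_cont[OF \<open>0 \<le> T\<close>] this]
    have "((\<lambda>s. (\<Prod>i\<in>I. h s i / s) * F k (\<xi> s)) \<longlongrightarrow>
        (\<Prod>i\<in>I. m * x i) * minus_D_pow k \<psi> T) (at_right 0)"
      by (intro tendsto_intros h_slope)
    moreover have "\<forall>\<^sub>F s in at_right 0. (\<Prod>i\<in>I. h s i / s) * F k (\<xi> s) = ?P s / s ^ k"
      using \<xi> by eventually_elim simp
    ultimately have "((\<lambda>s. ?P s / s ^ k) \<longlongrightarrow>
        (\<Prod>i\<in>I. m * x i) * minus_D_pow k \<psi> T) (at_right 0)"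
      by (rule Lim_transform_eventually)
    then show ?thesis
      by (simp add: T prod.distrib k_def)
  qed
  then show ?thesis
    using \<open>0 < m\<close> unfolding deriv_1 k_def \<psi>_def by auto
qed

end
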